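(* Let $p\ge 2$, let $X\subseteq\mathbb{R}^n$ be a nonempty convex set, and let $f=(f_1,f_2,\ldots,f_p)$, where $f_1,\ldots,f_p$ are real-valued convex functions on $X$. Then $$X_{WE}(f)=\bigcup_{\emptyset\neq\rho\subseteq\{1,2,\ldots,p\}}X_{PE}(f^{\rho}).$$
   Context: For vectors $a,b\in\mathbb{R}^m$: $a\leqq b$ means $a_j\le b_j$ for every $j$; $a\leq b$ means $a\leqq b$ and $a\neq b$; $a<b$ means $a_j<b_j$ for every $j$. Consider the multi-objective problem $\min f(x)=(f_1(x),\ldots,f_p(x))$ subject to $x\in X$. A point $\hat x\in X$ is a weakly efficient solution if there is no $x\in X$ with $f(x)<f(\hat x)$. The set of weakly efficient solutions is denoted $X_{WE}(f)$. For a nonempty $\rho\subseteq\{1,\ldots,p\}$, let $f^\rho(x)=(f_i(x);\ i\in\rho)$, and consider the problem $\min f^\rho(x)$ subject to $x\in X$. A point $\hat x\in X$ is an efficient solution of this problem if there is no $x\in X$ with $f^\rho(x)\leq f^\rho(\hat x)$. A point $\hat x\in X$ is a properly efficient solution (in the sense of Geoffrion) of this problem if it is efficient for it and there is a real number $M>0$ such that for all $i\in\rho$ and all $x\in X$ with $f_i(x)<f_i(\hat x)$ there exists an index $j\in\rho$ such that $f_j(x)>f_j(\hat x)$ and $$\frac{f_i(\hat x)-f_i(x)}{f_j(x)-f_j(\hat x)}\le M.$$ The set of properly efficient solutions of this problem is denoted $X_{PE}(f^\rho)$. (When $\rho$ is a singleton $\{i\}$, efficient and properly efficient solutions are both simply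 the minimizers of $f_i$ over $X$.) *)

theory Defs
  imports "HOL-Analysis.Analysis"
begin

text \<open>
  A vector with components indexed by a set \<open>I\<close> is a function of which only the values on \<open>I\<close>
  matter. The objective map is \<open>f :: 'i \<Rightarrow> 'a \<Rightarrow> real\<close>, with \<open>f i\<close> the \<open>i\<close>-th objective; the
  subproblem for \<open>\<rho>\<close> keeps the same \<open>f\<close> and uses \<open>\<rho>\<close> as index set.
\<close>

definition vec_leqq :: "'i set \<Rightarrow> ('i \<Rightarrow> real) \<Rightarrow> ('i \<Rightarrow> real) \<Rightarrow> bool" where
  "vec_leqq I a b \<longleftrightarrow> (\<forall>j\<in>I. a j \<le> b j)"

text \<open>The second conjunct says that the two vectors differ as vectors indexed by \<open>I\<close>.\<close>

definition vec_leq :: "'i set \<Rightarrow> ('i \<Rightarrow> real) \<Rightarrow> ('i \<Rightarrow> real) \<Rightarrow> bool" where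
  "vec_leq I a b \<longleftrightarrow> vec_leqq I a b \<and> \<not> (\<forall>j\<in>I. a j = b j)"

definition vec_less :: "'i set \<Rightarrow> ('i \<Rightarrow> real) \<Rightarrow> ('i \<Rightarrow> real) \<Rightarrow> bool" where
  "vec_less I a b \<longleftrightarrow> (\<forall>j\<in>I. a j < b j)"

definition weakly_efficient_set :: "'a set \<Rightarrow> 'i set \<Rightarrow> ('i \<Rightarrow> 'a \<Rightarrow> real) \<Rightarrow> 'a set" where
  "weakly_efficient_set X I f =
     {xh \<in> X. \<not> (\<exists>x\<in>X. vec_less I (\<lambda>i. f i x) (\<lambda>i. f i xh))}"

definition efficient_set :: "'a set \<Rightarrow> 'i set \<Rightarrow> ('i \<Rightarrow> 'a \<Rightarrow> real) \<Rightarrow> 'a set" where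
  "efficient_set X I f =
     {xh \<in> X. \<not> (\<exists>x\<in>X. vec_leq I (\<lambda>i. f i x) (\<lambda>i. f i xh))}"

text \<open>Proper efficiency in the sense of Geoffrion.\<close>

definition properly_efficient_set :: "'a set \<Rightarrow> 'i set \<Rightarrow> ('i \<Rightarrow> 'a \<Rightarrow> real) \<Rightarrow> 'a set" where
  "properly_efficient_set X I f =
     {xh \<in> efficient_set X I f.
        \<exists>M>0. \<forall>i\<in>I. \<forall>x\<in>X. f i x < f i xh \<longrightarrow>
          (\<exists>j\<in>I. f j x > f j xh \<and> (f i xh - f i x) / (f j x - f j xh) \<le> M)}"

end

theory Submission
  imports Defs
begin

text \<open>
  If \<open>xh\<close> is weakly efficient, the convex functions \<open>f i - f i xh\<close> are never simultaneously
  negative on \<open>X\<close>, so a theorem of the alternative gives nonnegative weights, not all zero, for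
  which \<open>xh\<close> minimizes the weighted sum. Taking \<open>\<rho>\<close> to be the support of the weights, all weights
  on \<open>\<rho>\<close> are positive, and Geoffrion's argument shows that \<open>xh\<close> is properly efficient for \<open>\<rho>\<close>.
  Conversely, a point dominated strictly in every objective is not efficient for any
  nonempty \<open>\<rho>\<close>.
\<close>

text \<open>Separation in the plane: the pairs lying strictly above some \<open>(g x, h x)\<close>
  form a convex set that misses the origin. The normal of a separating line supplies the weights;
  they are nonnegative because the set is closed under increasing either coordinate.\<close>

lemma convex_alternative_pair:
  fixes g h :: "'a::real_vector \<Rightarrow> real"
  assumes g: "convex_on X g" and h: "convex_on X h"
    and no: "\<And>x. x \<in> X \<Longrightarrow> \<not> (g x < 0 \<and> h x < 0)"
  shows "\<exists>a b. 0 \<le> a \<and> 0 \<le> b \<and> (a \<noteq> 0 \<or> b \<noteq> 0) \<and> (\<forall>x\<in>X. 0 \<le> a * g x + b * h x)"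
proof (cases "X = {}")
  \<comment> \<open>The empty set has to be covered: the induction in
    \<open>convex_alternative\<close> passes to a sublevel set that may be empty.\<close>
  case True
  then show ?thesis by (intro exI[of _ 1] exI[of _ 0]) auto
next
  case False
  then obtain x0 where x0: "x0 \<in> X" by blast
  \<comment> \<open>The image of \<open>(g, h)\<close> need not be convex; adding everything above
    it repairs this, and the strict inequalities keep 0 outside.\<close>
  define C where "C = {(s, t). \<exists>x\<in>X. g x < s \<and> h x < t}"
  have mem: "(s, t) \<in> C \<longleftrightarrow> (\<exists>x\<in>X. g x < s \<and> h x < t)" for s t
    by (simp add: C_def)
  have strict: "u * a + v * b < u * s + v * t"
    if "u \<ge> 0" "v \<ge> 0" "u + v = 1" "a < s" "b < t" for u v a b s t :: real
  proof (cases "u = 0")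
    case False
    with that have "u * a < u * s" "v * b \<le> v * t" by (auto intro: mult_left_mono)
    then show ?thesis by linarith
  qed (use that in auto)
  have "convex C"
  proof (rule convexI)
    fix y z :: "real \<times> real" and u v :: real
    assume y: "y \<in> C" and z: "z \<in> C" and uv: "u \<ge> 0" "v \<ge> 0" "u + v = 1"
    obtain s t s' t' where st: "y = (s, t)" "z = (s', t')" by (metis surj_pair)
    obtain x where x: "x \<in> X" "g x < s" "h x < t" using y st mem by blast
    obtain x' where x': "x' \<in> X" "g x' < s'" "h x' < t'" using z st mem by blast
    define w where "w = u *\<^sub>R x + v *\<^sub>R x'"
    have "w \<in> X"
      using convexD[OF convex_on_imp_convex[OF g] x(1) x'(1) uv] by (simp add: w_def)
    moreover have "g w \<le> u * g x + v * g x'" "h w \<le> u * h x + v * h x'"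
      using g h uv x(1) x'(1) unfolding w_def convex_on_def by blast+
    then have "g w < u * s + v * s'" "h w < u * t + v * t'"
      using strict[OF uv x(2) x'(2)] strict[OF uv x(3) x'(3)] by linarith+
    ultimately show "u *\<^sub>R y + v *\<^sub>R z \<in> C"
      by (auto simp: st mem)
  qed
  moreover have "0 \<notin> C" using no by (auto simp: zero_prod_def mem)
  ultimately obtain c where c: "c \<noteq> 0" "\<And>y. y \<in> C \<Longrightarrow> 0 \<le> inner c y"
    using separating_hyperplane_set_0[of C] by blast
  obtain a b where ab: "c = (a, b)" by fastforce
  have pos: "0 \<le> a * (g x + e) + b * (h x + d)" if "x \<in> X" "e > 0" "d > 0" for x e d
  proof -
    have "(g x + e, h x + d) \<in> C" unfolding mem using that by (intro bexI[of _ x]) auto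
    from c(2)[OF this] show ?thesis by (simp add: ab)
  qed
  have a: "0 \<le> a"
  proof (rule ccontr)
    assume "\<not> 0 \<le> a"
    then have an: "a < 0" by simp
    \<comment> \<open>Raising the first coordinate by \<open>r / (- a)\<close> changes the inner
      product by \<open>- r\<close>, and this \<open>r\<close> is large enough to bring it to at
      most -1.\<close>
    define r where "r = \<bar>a * g x0 + b * (h x0 + 1)\<bar> + 1"
    have "r > 0" by (simp add: r_def)
    then have "0 \<le> a * (g x0 + r / (- a)) + b * (h x0 + 1)"
      using pos[OF x0, of "r / (- a)" 1] an by (simp add: divide_pos_neg)
    moreover have "a * (r / (- a)) = - r" using an by simp
    ultimately show False by (simp only: distrib_left) (simp add: r_def distrib_left)
  qed
  have b: "0 \<le> b"
  proof (rule ccontr)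
    assume "\<not> 0 \<le> b"
    then have bn: "b < 0" by simp
    define r where "r = \<bar>b * h x0 + a * (g x0 + 1)\<bar> + 1"
    have "r > 0" by (simp add: r_def)
    then have "0 \<le> a * (g x0 + 1) + b * (h x0 + r / (- b))"
      using pos[OF x0, of 1 "r / (- b)"] bn by (simp add: divide_pos_neg)
    moreover have "b * (r / (- b)) = - r" using bn by simp
    ultimately show False by (simp only: distrib_left) (simp add: r_def distrib_left)
  qed
  have ab0: "a \<noteq> 0 \<or> b \<noteq> 0" using c(1) by (auto simp: ab zero_prod_def)
  then have abp: "a + b > 0" using a b by linarith
  have "0 \<le> a * g x + b * h x" if "x \<in> X" for x
  \<comment> \<open>A slack of \<open>e / (a + b)\<close> in both coordinates costs exactly
    \<open>e\<close>, so the slack can be sent to 0.\<close>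
  proof (rule field_le_epsilon)
    fix e :: real
    assume "e > 0"
    then have "0 \<le> a * (g x + e / (a + b)) + b * (h x + e / (a + b))"
      using pos[OF that] abp by simp
    also have "\<dots> = a * g x + b * h x + (a + b) * (e / (a + b))"
      by (simp only: distrib_left distrib_right)
    finally show "0 \<le> a * g x + b * h x + e" using abp by simp
  qed
  with a b ab0 show ?thesis by blast
qed

lemma convex_on_weighted_sum:
  assumes "convex X" "finite I"
    and "\<And>i. i \<in> I \<Longrightarrow> convex_on X (f i)" "\<And>i. i \<in> I \<Longrightarrow> 0 \<le> \<mu> i"
  shows "convex_on X (\<lambda>x. \<Sum>i\<in>I. \<mu> i * f i x :: real)"
  using assms(2-) by (induction I rule: finite_induct)
    (auto simp: convex_on_const[THEN iffD2, OF assms(1)] intro!: convex_on_add convex_on_cmul)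

text \<open>Induction on the index set, with \<open>X\<close> kept general: on the part of
  \<open>X\<close> where \<open>f k\<close> is negative the remaining functions satisfy the
  hypothesis, so they get weights there. Their weighted sum and \<open>f k\<close> are then never
  both negative on all of \<open>X\<close>, and the two-function case combines them.\<close>

lemma convex_alternative:
  fixes f :: "'i \<Rightarrow> 'a::real_vector \<Rightarrow> real"
  assumes "finite I" "I \<noteq> {}" "convex X"
    and "\<And>i. i \<in> I \<Longrightarrow> convex_on X (f i)"
    and "\<And>x. x \<in> X \<Longrightarrow> \<not> (\<forall>i\<in>I. f i x < 0)"
  shows "\<exists>\<mu>. (\<forall>i\<in>I. 0 \<le> \<mu> i) \<and> (\<exists>i\<in>I. \<mu> i \<noteq> 0) \<and> (\<forall>x\<in>X. 0 \<le> (\<Sum>i\<in>I. \<mu> i * f i x))"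
  using assms
proof (induction I arbitrary: X rule: finite_ne_induct)
  case (singleton k)
  then show ?case by (intro exI[of _ "\<lambda>_. 1"]) (auto simp: not_less)
next
  case (insert k I)
  define Y where "Y = {x \<in> X. f k x < 0}"
  have fk: "convex_on X (f k)" using insert.prems by simp
  have "convex Y"
  proof (rule convexI)
    fix x y and u v :: real
    assume xy: "x \<in> Y" "y \<in> Y" and uv: "u \<ge> 0" "v \<ge> 0" "u + v = 1"
    have "f k (u *\<^sub>R x + v *\<^sub>R y) \<le> u * f k x + v * f k y"
      using fk xy uv unfolding convex_on_def Y_def by blast
    also have "\<dots> < 0"
      using convex_bound_lt[of "f k x" 0 "f k y" u v] xy uv by (simp add: Y_def)
    finally show "u *\<^sub>R x + v *\<^sub>R y \<in> Y"
      using convexD[OF \<open>convex X\<close> _ _ uv, of x y] xy by (simp add: Y_def)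
  qed
  moreover have "convex_on Y (f i)" if "i \<in> I" for i
    using that insert.prems(2) convex_on_subset[of X "f i" Y] \<open>convex Y\<close> by (auto simp: Y_def)
  moreover have "\<not> (\<forall>i\<in>I. f i x < 0)" if "x \<in> Y" for x
    using that insert.prems(3) by (auto simp: Y_def)
  ultimately have "\<exists>\<mu>. (\<forall>i\<in>I. 0 \<le> \<mu> i) \<and> (\<exists>i\<in>I. \<mu> i \<noteq> 0) \<and>
      (\<forall>x\<in>Y. 0 \<le> (\<Sum>i\<in>I. \<mu> i * f i x))"
    by (rule insert.IH)
  then obtain \<mu> where \<mu>: "\<forall>i\<in>I. 0 \<le> \<mu> i" "\<exists>i\<in>I. \<mu> i \<noteq> 0"
      "\<forall>x\<in>Y. 0 \<le> (\<Sum>i\<in>I. \<mu> i * f i x)"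
    by blast
  have "convex_on X (\<lambda>x. \<Sum>i\<in>I. \<mu> i * f i x)"
    using insert.prems insert.hyps \<mu>(1) by (intro convex_on_weighted_sum) auto
  moreover have "\<not> ((\<Sum>i\<in>I. \<mu> i * f i x) < 0 \<and> f k x < 0)" if "x \<in> X" for x
    using \<mu>(3) that by (auto simp: Y_def not_less)
  ultimately have "\<exists>a b. 0 \<le> a \<and> 0 \<le> b \<and> (a \<noteq> 0 \<or> b \<noteq> 0) \<and>
      (\<forall>x\<in>X. 0 \<le> a * (\<Sum>i\<in>I. \<mu> i * f i x) + b * f k x)"
    using fk by (intro convex_alternative_pair)
  then obtain a b where ab: "0 \<le> a" "0 \<le> b" "a \<noteq> 0 \<or> b \<noteq> 0"
      "\<forall>x\<in>X. 0 \<le> a * (\<Sum>i\<in>I. \<mu> i * f i x) + b * f k x"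
    by blast
  define \<nu> where "\<nu> = (\<lambda>i. if i = k then b else a * \<mu> i)"
  have "(\<Sum>i\<in>insert k I. \<nu> i * f i x) = a * (\<Sum>i\<in>I. \<mu> i * f i x) + b * f k x" for x
  proof -
    have "(\<Sum>i\<in>I. \<nu> i * f i x) = (\<Sum>i\<in>I. a * (\<mu> i * f i x))"
      using insert.hyps by (intro sum.cong) (auto simp: \<nu>_def)
    then show ?thesis using insert.hyps by (simp add: \<nu>_def sum_distrib_left)
  qed
  moreover have "\<forall>i\<in>insert k I. 0 \<le> \<nu> i" using ab \<mu>(1) by (auto simp: \<nu>_def)
  \<comment> \<open>If \<open>a\<close> is nonzero, a nonzero \<open>\<mu> i\<close> survives the
    scaling; otherwise \<open>b\<close>, the weight of \<open>k\<close>, is nonzero.\<close>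
  moreover have "\<exists>i\<in>insert k I. \<nu> i \<noteq> 0"
    using ab(3) \<mu>(2) insert.hyps by (auto simp: \<nu>_def)
  ultimately show ?case using ab(4) by (intro exI[of _ \<nu>]) auto
qed

text \<open>If the ratio bound failed for a gain \<open>d\<close> in objective \<open>i\<close>,
  every other objective would worsen by at most \<open>d / M\<close>. For large \<open>M\<close> the
  weighted losses could not offset \<open>\<mu> i * d\<close>, contradicting minimality.\<close>

lemma weighted_sum_minimizer_properly_efficient:
  fixes f :: "'i \<Rightarrow> 'a \<Rightarrow> real"
  assumes fin: "finite I" and xh: "xh \<in> X"
    and pos: "\<And>i. i \<in> I \<Longrightarrow> 0 < \<mu> i"
    and min: "\<And>x. x \<in> X \<Longrightarrow> 0 \<le> (\<Sum>i\<in>I. \<mu> i * (f i x - f i xh))"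
  shows "xh \<in> properly_efficient_set X I f"
proof -
  have "\<not> vec_leq I (\<lambda>i. f i x) (\<lambda>i. f i xh)" if x: "x \<in> X" for x
  proof
    assume "vec_leq I (\<lambda>i. f i x) (\<lambda>i. f i xh)"
    then have le: "\<forall>i\<in>I. f i x \<le> f i xh" and "\<exists>i\<in>I. f i x < f i xh"
      by (auto simp: vec_leq_def vec_leqq_def less_le)
    then have "\<exists>i\<in>I. \<mu> i * (f i x - f i xh) < 0"
      by (meson mult_pos_neg pos diff_less_0_iff_less)
    with le have "(\<Sum>i\<in>I. \<mu> i * (f i x - f i xh)) < (\<Sum>i\<in>I. 0)"
      by (intro sum_strict_mono_ex1 fin) (auto simp: pos less_imp_le mult_nonneg_nonpos)
    with min[OF x] show False by simp
  qed
  then have eff: "xh \<in> efficient_set X I f" using xh by (auto simp: efficient_set_def)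
  define S where "S = (\<Sum>i\<in>I. \<mu> i)"
  \<comment> \<open>One constant exceeding \<open>S / \<mu> i\<close> for all \<open>i\<close> at
    once; the summand 1 makes this strict and \<open>M\<close> positive.\<close>
  define M where "M = 1 + (\<Sum>i\<in>I. S / \<mu> i)"
  have S: "S \<ge> 0" unfolding S_def by (intro sum_nonneg) (simp add: pos less_imp_le)
  have ge: "(\<Sum>i\<in>I. S / \<mu> i) \<ge> 0" by (intro sum_nonneg) (simp add: S pos less_imp_le)
  then have M: "M > 0" by (simp add: M_def)
  have "\<exists>j\<in>I. f j x > f j xh \<and> (f i xh - f i x) / (f j x - f j xh) \<le> M"
    if i: "i \<in> I" and x: "x \<in> X" and lt: "f i x < f i xh" for i x
  proof (rule ccontr)
    assume neg: "\<not> ?thesis"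
    define d where "d = f i xh - f i x"
    have d: "d > 0" using lt by (simp add: d_def)
    have bound: "f j x - f j xh \<le> d / M" if j: "j \<in> I" for j
    proof (cases "f j x > f j xh")
      case True
      with neg j have "M < d / (f j x - f j xh)" by (auto simp: d_def)
      with True M show ?thesis by (simp add: field_simps)
    next
      case False
      moreover have "0 < d / M" using d M by simp
      ultimately show ?thesis by linarith
    qed
    have "S / \<mu> i \<le> (\<Sum>i\<in>I. S / \<mu> i)"
      by (rule member_le_sum[OF i _ fin]) (simp add: S pos less_imp_le)
    then have "S / \<mu> i < M" by (simp add: M_def)
    then have SM: "S / M < \<mu> i" using M pos[OF i] by (simp add: field_simps)
    have "0 \<le> (\<Sum>j\<in>I. \<mu> j * (f j x - f j xh))" using min[OF x] .
    also have "\<dots> = \<mu> i * (f i x - f i xh) + (\<Sum>j\<in>I-{i}. \<mu> j * (f j x - f j xh))"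
      by (rule sum.remove[OF fin i])
    also have "\<dots> \<le> - (\<mu> i * d) + (\<Sum>j\<in>I-{i}. \<mu> j * (d / M))"
      by (intro add_mono sum_mono mult_left_mono bound)
        (auto simp: d_def pos less_imp_le algebra_simps)
    \<comment> \<open>Restoring the nonnegative term for \<open>i\<close> turns the sum of weights
      into \<open>S\<close>.\<close>
    also have "(\<Sum>j\<in>I-{i}. \<mu> j * (d / M)) \<le> (\<Sum>j\<in>I. \<mu> j * (d / M))"
      using d M by (intro sum_mono2 fin) (auto simp: pos less_imp_le)
    also have "(\<Sum>j\<in>I. \<mu> j * (d / M)) = S / M * d"
      by (simp add: S_def sum_distrib_right sum_divide_distrib)
    also have "- (\<mu> i * d) + S / M * d < 0"
      using mult_strict_right_mono[OF SM d] by simp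
    finally show False by simp
  qed
  then show ?thesis using eff M unfolding properly_efficient_set_def by blast
qed

theorem theorem3p4:
  fixes X :: "(real ^ 'n) set" and f :: "nat \<Rightarrow> real ^ 'n \<Rightarrow> real" and p :: nat
  assumes "p \<ge> 2"
    and "X \<noteq> {}"
    and "convex X"
    and "\<And>i. i \<in> {1..p} \<Longrightarrow> convex_on X (f i)"
  shows "weakly_efficient_set X {1..p} f =
    (\<Union>\<rho>\<in>{\<rho>. \<rho> \<noteq> {} \<and> \<rho> \<subseteq> {1..p}}. properly_efficient_set X \<rho> f)"
proof (intro equalityI subsetI)
  fix xh
  assume "xh \<in> weakly_efficient_set X {1..p} f"
  then have xh: "xh \<in> X" and
    no: "\<And>x. x \<in> X \<Longrightarrow> \<not> (\<forall>i\<in>{1..p}. f i x - f i xh < 0)"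
    by (auto simp: weakly_efficient_set_def vec_less_def)
  have "convex_on X (\<lambda>x. f i x - f i xh)" if "i \<in> {1..p}" for i
    using convex_on_add[OF assms(4)[OF that] convex_on_const[THEN iffD2, OF assms(3)],
        of "- f i xh"] by simp
  then obtain \<mu> where \<mu>: "\<forall>i\<in>{1..p}. 0 \<le> \<mu> i" "\<exists>i\<in>{1..p}. \<mu> i \<noteq> 0"
      "\<forall>x\<in>X. 0 \<le> (\<Sum>i\<in>{1..p}. \<mu> i * (f i x - f i xh))"
    using convex_alternative[of "{1..p}" X "\<lambda>i x. f i x - f i xh"] assms(1,3) no by auto
  \<comment> \<open>Discarding the zero weights leaves the weighted sum unchanged and makes all
    remaining weights positive, as the scalarization lemma demands.\<close>
  define \<rho> where "\<rho> = {i \<in> {1..p}. \<mu> i \<noteq> 0}"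
  have "(\<Sum>i\<in>\<rho>. \<mu> i * (f i x - f i xh)) = (\<Sum>i\<in>{1..p}. \<mu> i * (f i x - f i xh))" for x
    by (rule sum.mono_neutral_left) (auto simp: \<rho>_def)
  then have "xh \<in> properly_efficient_set X \<rho> f"
    using \<mu> by (intro weighted_sum_minimizer_properly_efficient[where \<mu> = \<mu>] xh)
      (auto simp: \<rho>_def less_le)
  moreover have "\<rho> \<noteq> {}" "\<rho> \<subseteq> {1..p}" using \<mu>(2) by (auto simp: \<rho>_def)
  ultimately show "xh \<in> (\<Union>\<rho>\<in>{\<rho>. \<rho> \<noteq> {} \<and> \<rho> \<subseteq> {1..p}}. properly_efficient_set X \<rho> f)"
    by blast
next
  fix xh
  assume "xh \<in> (\<Union>\<rho>\<in>{\<rho>. \<rho> \<noteq> {} \<and> \<rho> \<subseteq> {1..p}}. properly_efficient_set X \<rho> f)"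
  then obtain \<rho> where \<rho>: "\<rho> \<noteq> {}" "\<rho> \<subseteq> {1..p}" and "xh \<in> efficient_set X \<rho> f"
    by (auto simp: properly_efficient_set_def)
  then have xh: "xh \<in> X" and no: "\<And>x. x \<in> X \<Longrightarrow> \<not> vec_leq \<rho> (\<lambda>i. f i x) (\<lambda>i. f i xh)"
    by (auto simp: efficient_set_def)
  have "vec_leq \<rho> (\<lambda>i. f i x) (\<lambda>i. f i xh)" if "vec_less {1..p} (\<lambda>i. f i x) (\<lambda>i. f i xh)" for x
  proof -
    have "\<forall>i\<in>\<rho>. f i x < f i xh" using that \<rho>(2) by (auto simp: vec_less_def)
    \<comment> \<open>An element of \<open>\<rho>\<close> provides the coordinate in which the two
      vectors differ.\<close>
    then show ?thesis using \<rho>(1) by (fastforce simp: vec_leq_def vec_leqq_def)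
  qed
  with xh no show "xh \<in> weakly_efficient_set X {1..p} f"
    by (auto simp: weakly_efficient_set_def)
qed

end
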